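(* Let $(C_k)_{k\ge 0}$ be the Lucas-balancing sequence. Suppose that there exist positive integers $k, m, n$ with $n \ge 2$ and digits $d_1, d_2 \in \{1,2,\dots,9\}$ such that \[ C_k = d_1\left(\frac{10^n-1}{9}\right) - d_2\left(\frac{10^m-1}{9}\right), \] i.e. $C_k$ is the difference of the repdigit consisting of $n$ copies of the digit $d_1$ and the repdigit consisting of $m$ copies of the digit $d_2$. Then $C_k \in \{3, 17\}$. Both values occur: $C_1 = 3 = 11 - 8$ and $C_2 = 17 = 22 - 5$.
   Context: The Lucas-balancing sequence $(C_k)_{k\ge0}$ is defined by $C_0=1$, $C_1=3$ and $C_{k+1}=6C_k-C_{k-1}$ for $k\ge1$. A repdigit is a positive integer all of whose decimal digits are equal. A repdigit with $n$ digits all equal to $d\in\{1,\dots,9\}$ is $d(10^n-1)/9$. *)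

theory Defs
  imports Main
begin

fun lucas_balancing :: "nat \<Rightarrow> int" where
  "lucas_balancing 0 = 1"
| "lucas_balancing (Suc 0) = 3"
| "lucas_balancing (Suc (Suc k)) = 6 * lucas_balancing (Suc k) - lucas_balancing k"

text \<open>
  The integer division by 9 below is exact. The value is the number whose
  decimal expansion consists of \<open>n\<close> copies of the digit \<open>d\<close>; see
  \<open>repdigit_eq_digit_sum\<close>.
\<close>

definition repdigit :: "nat \<Rightarrow> nat \<Rightarrow> int" where
  "repdigit d n = int d * ((10 ^ n - 1) div 9)"

lemma nine_mult_sum_power_ten: "9 * (\<Sum>i<n. (10::int) ^ i) = 10 ^ n - 1"
  by (induction n) (simp_all add: algebra_simps)

lemma repdigit_eq_digit_sum: "repdigit d n = (\<Sum>i<n. int d * 10 ^ i)"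
proof -
  have "((10::int) ^ n - 1) div 9 = (\<Sum>i<n. 10 ^ i)"
    by (simp flip: nine_mult_sum_power_ten)
  then show ?thesis
    by (simp add: repdigit_def sum_distrib_left)
qed

end

theory Submission
  imports Defs
begin

text \<open>
  Write \<open>R\<^sub>n\<close> for the repunit with \<open>n\<close> digits. Since \<open>R\<^sub>n\<^sub>+\<^sub>5 = R\<^sub>n + 11111 \<cdot> 10\<^sup>n\<close> and
  \<open>11111 = 41 \<cdot> 271\<close>, the repunits are periodic with period 5 from index 6 on, modulo
  each of 64, 25, 41 and 271. The Lucas-balancing numbers are periodic modulo these numbers too,
  and they cover few residue classes. Comparing residues leaves no solution with \<open>n \<ge> 3\<close>, so no
  linear forms in logarithms are needed. For \<open>n = 2\<close> the value is below \<open>C\<^sub>3 = 99\<close>.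
\<close>

section \<open>Repunits modulo \<open>11111 * 10 ^ 6\<close>\<close>

definition repunit :: "nat \<Rightarrow> int" where
  "repunit n = (10 ^ n - 1) div 9"

lemma nine_mult_repunit: "9 * repunit n = 10 ^ n - 1"
  unfolding repunit_def by (simp flip: nine_mult_sum_power_ten)

lemma repdigit_repunit: "repdigit d n = int d * repunit n"
  by (simp add: repdigit_def repunit_def)

lemma repunit_pos: "n \<ge> 1 \<Longrightarrow> repunit n \<ge> 1"
proof -
  assume "n \<ge> 1"
  then have "(10::int) ^ 1 \<le> 10 ^ n"
    by (intro power_increasing) simp_all
  then show ?thesis
    using nine_mult_repunit[of n] by simp
qed

lemma repunit_add_5: "repunit (n + 5) = repunit n + 11111 * 10 ^ n"
proof -
  have "9 * repunit (n + 5) = 9 * (repunit n + 11111 * 10 ^ n)"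
    by (simp add: nine_mult_repunit power_add ring_distribs)
  then show ?thesis
    by simp
qed

text \<open>The increment \<open>11111 * 10 ^ n\<close> vanishes for this modulus, in which
  \<open>10 ^ 6\<close> supplies the factors 64 and 25, and 11111 the factors 41 and 271.\<close>

lemma repunit_mod_add_5:
  assumes "n \<ge> 6"
  shows "repunit (n + 5) mod (11111 * 10 ^ 6) = repunit n mod (11111 * 10 ^ 6)"
proof -
  have "(10::int) ^ n = 10 ^ 6 * 10 ^ (n - 6)"
    using power_add[of "10::int" 6 "n - 6"] assms by (simp del: power_numeral)
  then have "repunit (n + 5) = repunit n + (11111 * 10 ^ 6) * 10 ^ (n - 6)"
    by (simp add: repunit_add_5)
  then show ?thesis
    by (metis mod_mult_self2)
qed

text \<open>Steps of 5 are taken only from indices above 10, so they end at 6 or later and the lower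
  bound \<open>a\<close> survives.\<close>

lemma repunit_mod_reduce:
  assumes "a \<le> n" and "a \<le> 6"
  obtains n' where "n' \<in> {a..10}"
    and "repunit n mod (11111 * 10 ^ 6) = repunit n' mod (11111 * 10 ^ 6)"
proof -
  have "\<exists>n'\<in>{a..10}. repunit n mod (11111 * 10 ^ 6) = repunit n' mod (11111 * 10 ^ 6)"
    using assms
  proof (induction n rule: less_induct)
    case (less n)
    show ?case
    proof (cases "n \<le> 10")
      case True
      then show ?thesis
        using less.prems by auto
    next
      case False
      then have "repunit n mod (11111 * 10 ^ 6) = repunit (n - 5) mod (11111 * 10 ^ 6)"
        using repunit_mod_add_5[of "n - 5"] by simp
      then show ?thesis
        using less.IH[of "n - 5"] less.prems False by simp
    qed
  qed
  then show ?thesis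
    using that by blast
qed

section \<open>Growth and residues of the Lucas-balancing numbers\<close>

lemma lucas_balancing_2: "lucas_balancing 2 = 17"
  by (simp add: numeral_2_eq_2)

lemma lucas_balancing_increasing:
  "lucas_balancing k \<ge> 1 \<and> lucas_balancing k \<le> lucas_balancing (Suc k)"
  by (induction k) auto

lemma lucas_balancing_ge_99:
  assumes "k \<ge> 3"
  shows "lucas_balancing k \<ge> 99"
proof -
  have "lucas_balancing 3 \<le> lucas_balancing k"
    using lucas_balancing_increasing assms by (blast intro: lift_Suc_mono_le)
  then show ?thesis
    by (simp add: numeral_3_eq_3)
qed

text \<open>Carrying two consecutive residues makes evaluation linear in the length, unlike the
  doubly recursive \<open>lucas_balancing\<close>.\<close>

fun lucas_residues :: "int \<Rightarrow> int \<Rightarrow> int \<Rightarrow> nat \<Rightarrow> int list" where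
  "lucas_residues p a b 0 = []"
| "lucas_residues p a b (Suc j) = a # lucas_residues p b ((6 * b - a) mod p) j"

lemma lucas_residues_eq:
  "lucas_residues p (lucas_balancing k mod p) (lucas_balancing (Suc k) mod p) j
    = map (\<lambda>i. lucas_balancing (k + i) mod p) [0..<j]"
proof (induction j arbitrary: k)
  case 0
  then show ?case by simp
next
  case (Suc j)
  have "(6 * (lucas_balancing (Suc k) mod p) - lucas_balancing k mod p) mod p
      = lucas_balancing (Suc (Suc k)) mod p"
    unfolding lucas_balancing.simps by (intro mod_diff_cong mod_mult_cong) simp_all
  then show ?case
    using Suc.IH[of "Suc k"] by (simp add: map_upt_Suc del: upt_Suc)
qed

text \<open>Two consecutive residues determine all later ones, so a return of the initial pair
  forces a period.\<close>

lemma lucas_balancing_mod_period: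
  assumes "lucas_balancing P mod p = 1 mod p"
    and "lucas_balancing (Suc P) mod p = 3 mod p"
  shows "lucas_balancing (k + P) mod p = lucas_balancing k mod p"
proof (induction k rule: lucas_balancing.induct)
  case (3 k)
  have "lucas_balancing (Suc (Suc k) + P) mod p
      = (6 * (lucas_balancing (Suc k + P) mod p) - lucas_balancing (k + P) mod p) mod p"
    unfolding add_Suc lucas_balancing.simps by (intro mod_diff_cong mod_mult_cong) simp_all
  also have "\<dots> = lucas_balancing (Suc (Suc k)) mod p"
    unfolding 3 lucas_balancing.simps by (intro mod_diff_cong mod_mult_cong) simp_all
  finally show ?case .
qed (use assms in simp_all)

text \<open>The last hypothesis is the computable form of the return of the pair 1, 3 at index
  \<open>P\<close>; one period then lists every residue.\<close>

lemma lucas_balancing_mod_mem: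
  assumes "p > 3" and "P > 0" and "drop P (lucas_residues p 1 3 (P + 2)) = [1, 3]"
  shows "lucas_balancing k mod p \<in> set (lucas_residues p 1 3 P)"
proof -
  have residues: "lucas_residues p 1 3 j = map (\<lambda>i. lucas_balancing i mod p) [0..<j]" for j
    using lucas_residues_eq[of p 0 j] assms(1) by simp
  have "lucas_balancing P mod p = 1" and "lucas_balancing (Suc P) mod p = 3"
    using assms(3) unfolding residues by (simp_all add: drop_map upt_conv_Cons)
  then have "lucas_balancing (k + P) mod p = lucas_balancing k mod p" for k
    using assms(1) by (intro lucas_balancing_mod_period) simp_all
  then have "lucas_balancing (i + P * j) mod p = lucas_balancing i mod p" for i j
    by (induction j) (simp_all add: add.assoc[symmetric] add.commute[of P])
  from this[of "k mod P" "k div P"]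
  have "lucas_balancing k mod p = lucas_balancing (k mod P) mod p"
    by simp
  then show ?thesis
    using assms(2) by (simp add: residues)
qed

text \<open>The list length 5 is a period modulo 41, as are 8, 30 and 135 below for 64, 25 and
  271.\<close>

lemma lucas_balancing_mod_41: "lucas_balancing k mod 41 \<in> {1, 3, 17}"
proof -
  have "lucas_balancing k mod 41 \<in> set (lucas_residues 41 1 3 5)"
    by (rule lucas_balancing_mod_mem) code_simp+
  also have "set (lucas_residues 41 1 3 5) = {1, 3, 17}"
    by code_simp
  finally show ?thesis .
qed

lemma lucas_balancing_mod_64: "lucas_balancing k mod 64 \<in> {1, 3, 17, 35}"
proof -
  have "lucas_balancing k mod 64 \<in> set (lucas_residues 64 1 3 8)"
    by (rule lucas_balancing_mod_mem) code_simp+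
  also have "set (lucas_residues 64 1 3 8) = {1, 3, 17, 35}"
    by code_simp
  finally show ?thesis .
qed

lemma lucas_balancing_mod_25:
  "lucas_balancing k mod 25 \<in> {1, 2, 3, 7, 8, 12, 13, 17, 18, 22, 23, 24}"
proof -
  have "lucas_balancing k mod 25 \<in> set (lucas_residues 25 1 3 30)"
    by (rule lucas_balancing_mod_mem) code_simp+
  also have "set (lucas_residues 25 1 3 30) = {1, 2, 3, 7, 8, 12, 13, 17, 18, 22, 23, 24}"
    by code_simp
  finally show ?thesis .
qed

text \<open>
  115 and 226 are the residues of \<open>666 - 9\<close> and \<open>999999 - 2222\<close>, the only candidates with
  \<open>n \<ge> 3\<close> that survive the other three moduli.
\<close>

lemma lucas_balancing_mod_271: "lucas_balancing k mod 271 \<notin> {115, 226}"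
proof -
  have "lucas_balancing k mod 271 \<in> set (lucas_residues 271 1 3 135)"
    by (rule lucas_balancing_mod_mem) code_simp+
  moreover have "115 \<notin> set (lucas_residues 271 1 3 135)"
    and "226 \<notin> set (lucas_residues 271 1 3 135)"
    by code_simp+
  ultimately show ?thesis
    by (metis empty_iff insert_iff)
qed

section \<open>The finite sieve\<close>

text \<open>Filtering one modulus after the other keeps the lists short during symbolic evaluation.\<close>

definition admissible :: "int list \<Rightarrow> int list" where
  "admissible xs =
    filter (\<lambda>v. v mod 271 \<notin> {115, 226})
      (filter (\<lambda>v. v mod 25 \<in> {1, 2, 3, 7, 8, 12, 13, 17, 18, 22, 23, 24})
        (filter (\<lambda>v. v mod 64 \<in> {1, 3, 17, 35})
          (filter (\<lambda>v. v mod 41 \<in> {1, 3, 17}) xs)))"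

lemma mem_admissible:
  assumes "v \<in> set xs" and "lucas_balancing k mod (11111 * 10 ^ 6) = v mod (11111 * 10 ^ 6)"
  shows "v \<in> set (admissible xs)"
proof -
  have residue: "v mod p = lucas_balancing k mod p" if "p dvd 11111 * 10 ^ 6" for p
    using arg_cong[OF assms(2), of "\<lambda>x. x mod p"] by (simp only: mod_mod_cancel[OF that])
  have "v mod 41 \<in> {1, 3, 17}"
    using lucas_balancing_mod_41[of k] by (subst residue) simp_all
  moreover have "v mod 64 \<in> {1, 3, 17, 35}"
    using lucas_balancing_mod_64[of k] by (subst residue) simp_all
  moreover have "v mod 25 \<in> {1, 2, 3, 7, 8, 12, 13, 17, 18, 22, 23, 24}"
    using lucas_balancing_mod_25[of k] by (subst residue) simp_all
  moreover have "v mod 271 \<notin> {115, 226}"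
    using lucas_balancing_mod_271[of k] by (subst residue) simp_all
  ultimately show ?thesis
    unfolding admissible_def set_filter mem_Collect_eq using assms(1) by (intro conjI)
qed

definition differences :: "int list \<Rightarrow> int \<Rightarrow> int \<Rightarrow> int list" where
  "differences ds x y = [a * x - b * y. a \<leftarrow> ds, b \<leftarrow> ds]"

lemma mem_differences:
  assumes "a \<in> set ds" and "b \<in> set ds"
  shows "a * x - b * y \<in> set (differences ds x y)"
  unfolding differences_def using assms by auto

text \<open>
  Matching on the pair prevents symbolic evaluation from unfolding the body before the
  arguments are known.
\<close>

fun no_admissible_difference :: "int \<times> int \<Rightarrow> bool" where
  "no_admissible_difference (x, y) \<longleftrightarrow> admissible (differences [1..9] x y) = []"

text \<open>The first index starts at 3 because the genuine solutions 11 - 8 and 22 - 5 would pass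
  the sieve.\<close>

lemma no_admissible_difference_repunit:
  "list_all no_admissible_difference
    (List.product (map repunit [3..<11]) (map repunit [1..<11]))"
  by code_simp

theorem theorem3:
  shows "(\<forall>k m n d1 d2 :: nat.
            k \<ge> 1 \<and> m \<ge> 1 \<and> n \<ge> 2 \<and> d1 \<in> {1..9} \<and> d2 \<in> {1..9} \<and>
            lucas_balancing k = repdigit d1 n - repdigit d2 m
            \<longrightarrow> lucas_balancing k \<in> {3, 17})
       \<and> (lucas_balancing 1 = 3 \<and> repdigit 1 2 = 11 \<and> repdigit 8 1 = 8 \<and>
          lucas_balancing 1 = repdigit 1 2 - repdigit 8 1)
       \<and> (lucas_balancing 2 = 17 \<and> repdigit 2 2 = 22 \<and> repdigit 5 1 = 5 \<and>
          lucas_balancing 2 = repdigit 2 2 - repdigit 5 1)"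
proof (intro conjI allI impI)
  fix k m n d1 d2 :: nat
  assume "k \<ge> 1 \<and> m \<ge> 1 \<and> n \<ge> 2 \<and> d1 \<in> {1..9} \<and> d2 \<in> {1..9} \<and>
    lucas_balancing k = repdigit d1 n - repdigit d2 m"
  then have k: "k \<ge> 1" and m: "m \<ge> 1" and n: "n \<ge> 2" and d1: "d1 \<in> {1..9}" and d2: "d2 \<in> {1..9}"
    and eq: "lucas_balancing k = int d1 * repunit n - int d2 * repunit m"
    by (auto simp: repdigit_repunit)
  have "n = 2"
  proof (rule ccontr)
    assume "n \<noteq> 2"
    then have "3 \<le> n"
      using n by simp
    then obtain n' where n': "n' \<in> {3..10}"
      "repunit n mod (11111 * 10 ^ 6) = repunit n' mod (11111 * 10 ^ 6)"
      by (rule repunit_mod_reduce) simp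
    obtain m' where m': "m' \<in> {1..10}"
      "repunit m mod (11111 * 10 ^ 6) = repunit m' mod (11111 * 10 ^ 6)"
      using m by (rule repunit_mod_reduce) simp
    \<comment> \<open>\<open>v\<close> need not be a Lucas-balancing number; it only shares the
      residue of one.\<close>
    define v where "v = int d1 * repunit n' - int d2 * repunit m'"
    have "int d1 \<in> set [1..9]" and "int d2 \<in> set [1..9]"
      using d1 d2 by auto
    then have "v \<in> set (differences [1..9] (repunit n') (repunit m'))"
      unfolding v_def by (rule mem_differences)
    moreover have "lucas_balancing k mod (11111 * 10 ^ 6) = v mod (11111 * 10 ^ 6)"
      unfolding eq v_def by (intro mod_diff_cong mod_mult_cong n' m' refl)
    ultimately have "v \<in> set (admissible (differences [1..9] (repunit n') (repunit m')))"
      by (rule mem_admissible)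
    moreover have "no_admissible_difference (repunit n', repunit m')"
    proof -
      have "(repunit n', repunit m')
          \<in> set (List.product (map repunit [3..<11]) (map repunit [1..<11]))"
        unfolding set_product set_map set_upt using n'(1) m'(1) by (auto intro!: imageI)
      then show ?thesis
        using no_admissible_difference_repunit unfolding list_all_iff by blast
    qed
    ultimately show False
      by simp
  qed
  then have "int d1 * repunit n \<le> 99"
    using d1 by (simp add: repunit_def)
  \<comment> \<open>Subtracting at least 1 makes the bound strict, which excludes the value 99 at
    index 3.\<close>
  moreover have "1 * 1 \<le> int d2 * repunit m"
    using d2 repunit_pos[OF m] by (intro mult_mono) auto
  ultimately have "lucas_balancing k < 99"
    using eq by simp
  then have "k < 3"
    using lucas_balancing_ge_99[of k] by linarith
  then have "k = 1 \<or> k = 2"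
    using k by auto
  then show "lucas_balancing k \<in> {3, 17}"
    by (auto simp: lucas_balancing_2)
qed (simp_all add: repdigit_def lucas_balancing_2)

end
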